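(* Let $\mathcal{C}$ be a category, let $(\mathcal{N},\leq)$ be a poset, and let $\mathbf{I}:\mathrm{Ob}(\mathcal{C})\sqcup\mathrm{Mor}(\mathcal{C})\to\mathcal{N}$ be a categorical invariant of $\mathcal{C}$. Then the persistence $\mathbf{I}$-invariant is $1$-Lipschitz stable: for any two functors $F_\bullet,G_\bullet:(\mathbb{R},\leq)\to\mathcal{C}$, $$d_{\mathrm{E}}(\mathbf{I}(F_\bullet),\mathbf{I}(G_\bullet))\leq d_{\mathrm{I}}(F_\bullet,G_\bullet).$$
   Context: An ($\mathcal{N}$-valued) categorical invariant of $\mathcal{C}$ is a map $\mathbf{I}$ assigning an element of the poset $\mathcal{N}$ to each object and each morphism of $\mathcal{C}$ such that (i) $\mathbf{I}(\mathrm{id}_X)=\mathbf{I}(X)$ for every object $X$, and (ii) $\mathbf{I}(h\circ g\circ f)\leq\mathbf{I}(g)$ for all composable morphisms $X\xrightarrow{f}Y\xrightarrow{g}W\xrightarrow{h}Z$. A persistent object in $\mathcal{C}$ is a functor $F_\bullet:(\mathbb{R},\leq)\to\mathcal{C}$, with objects $F_t$ and transition morphisms $f_a^b:F_a\to F_b$ for $a\leq b$. Let $\mathrm{Int}$ be the set of closed intervals $[a,b]$ with $a\leq b$ in $\mathbb{R}$, ordered by inclusion. The persistence $\mathbf{I}$-invariant of $F_\bullet$ is the functor $\mathbf{I}(F_\bullet):(\mathrm{Int},\subseteq)\to(\mathcal{N},\leq)^{\mathrm{op}}$, $[a,b]\mapsto\mathbf{I}(f_a^b)$. Interleaving distance: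 $F_\bullet,G_\bullet$ (with transition maps $f_a^b$, $g_a^b$) are $\epsilon$-interleaved ($\epsilon\geq 0$) if there are families of morphisms $\varphi_t:F_t\to G_{t+\epsilon}$ and $\psi_t:G_t\to F_{t+\epsilon}$ ($t\in\mathbb{R}$) with $\varphi_b\circ f_a^b=g_{a+\epsilon}^{b+\epsilon}\circ\varphi_a$ and $\psi_b\circ g_a^b=f_{a+\epsilon}^{b+\epsilon}\circ\psi_a$ for all $a\leq b$, and $\psi_{t+\epsilon}\circ\varphi_t=f_t^{t+2\epsilon}$, $\varphi_{t+\epsilon}\circ\psi_t=g_t^{t+2\epsilon}$ for all $t$. Then $d_{\mathrm{I}}(F_\bullet,G_\bullet)$ is the infimum of all $\epsilon\geq0$ for which they are $\epsilon$-interleaved ($\infty$ if none). Erosion distance: functors $\mathbf{J}_1,\mathbf{J}_2:(\mathrm{Int},\subseteq)\to(\mathcal{N},\leq)^{\mathrm{op}}$ are $\epsilon$-eroded if $\mathbf{J}_1([a,b])\geq\mathbf{J}_2([a-\epsilon,b+\epsilon])$ and $\mathbf{J}_2([a,b])\geq\mathbf{J}_1([a-\epsilon,b+\epsilon])$ for all $[a,b]\in\mathrm{Int}$; $d_{\mathrm{E}}(\mathbf{J}_1,\mathbf{J}_2)$ is the infimum of all $\epsilon\geq 0$ such that they are $\epsilon$-eroded ($\infty$ if none). *)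

theory Defs
  imports "HOL-Library.Interval" "HOL-Library.Extended_Nonnegative_Real"
begin

section \<open>Categories and functors\<close>

record ('o, 'm) cat =
  Ob :: "'o set"
  Mor :: "'m set"
  src :: "'m \<Rightarrow> 'o"
  tgt :: "'m \<Rightarrow> 'o"
  ident :: "'o \<Rightarrow> 'm"
  cmp :: "'m \<Rightarrow> 'm \<Rightarrow> 'm"  (infixr \<open>\<cdot>\<index>\<close> 55)

definition Hom :: "('o, 'm) cat \<Rightarrow> 'o \<Rightarrow> 'o \<Rightarrow> 'm set" where
  "Hom C X Y = {f \<in> Mor C. src C f = X \<and> tgt C f = Y}"

locale category =
  fixes C :: "('o, 'm) cat" (structure)
  assumes src_in_Ob: "f \<in> Mor C \<Longrightarrow> src C f \<in> Ob C"
    and tgt_in_Ob: "f \<in> Mor C \<Longrightarrow> tgt C f \<in> Ob C"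
    and ident_in_Hom: "X \<in> Ob C \<Longrightarrow> ident C X \<in> Hom C X X"
    and cmp_in_Hom: "f \<in> Hom C X Y \<Longrightarrow> g \<in> Hom C Y Z \<Longrightarrow> g \<cdot> f \<in> Hom C X Z"
    and cmp_ident_right: "f \<in> Hom C X Y \<Longrightarrow> f \<cdot> ident C X = f"
    and cmp_ident_left: "f \<in> Hom C X Y \<Longrightarrow> ident C Y \<cdot> f = f"
    and cmp_assoc: "f \<in> Hom C X Y \<Longrightarrow> g \<in> Hom C Y W \<Longrightarrow> h \<in> Hom C W Z
      \<Longrightarrow> (h \<cdot> g) \<cdot> f = h \<cdot> (g \<cdot> f)"

record ('o, 'm, 'p, 'q) func =
  on_ob :: "'o \<Rightarrow> 'p"
  on_mor :: "'m \<Rightarrow> 'q"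

locale category_functor = C: category C + D: category D
  for C :: "('o, 'm) cat" and D :: "('p, 'q) cat" +
  fixes F :: "('o, 'm, 'p, 'q) func"
  assumes on_ob_in_Ob: "X \<in> Ob C \<Longrightarrow> on_ob F X \<in> Ob D"
    and on_mor_in_Hom: "f \<in> Hom C X Y \<Longrightarrow> on_mor F f \<in> Hom D (on_ob F X) (on_ob F Y)"
    and on_mor_ident: "X \<in> Ob C \<Longrightarrow> on_mor F (ident C X) = ident D (on_ob F X)"
    and on_mor_cmp: "f \<in> Hom C X Y \<Longrightarrow> g \<in> Hom C Y Z
      \<Longrightarrow> on_mor F (g \<cdot>\<^bsub>C\<^esub> f) = on_mor F g \<cdot>\<^bsub>D\<^esub> on_mor F f"

definition opposite :: "('o, 'm) cat \<Rightarrow> ('o, 'm) cat" where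
  "opposite C = \<lparr>Ob = Ob C, Mor = Mor C, src = tgt C, tgt = src C, ident = ident C,
     cmp = (\<lambda>g f. f \<cdot>\<^bsub>C\<^esub> g)\<rparr>"

text \<open>A poset as a category: the unique morphism \<open>x \<rightarrow> y\<close> for \<open>x \<le> y\<close> is the pair \<open>(x, y)\<close>.\<close>

definition poset_category :: "('a::order, 'a \<times> 'a) cat" where
  "poset_category = \<lparr>Ob = UNIV, Mor = {(x, y). x \<le> y}, src = fst, tgt = snd,
     ident = (\<lambda>x. (x, x)), cmp = (\<lambda>g f. (fst f, snd g))\<rparr>"

lemma category_poset_category: "category poset_category"
  by unfold_locales (auto simp: poset_category_def Hom_def)

lemma category_opposite:
  assumes "category C"
  shows "category (opposite C)"
proof -
  interpret category C by fact
  have Hom: "Hom (opposite C) X Y = Hom C Y X" for X Y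
    by (auto simp: opposite_def Hom_def)
  show ?thesis
    by unfold_locales
      (auto simp: Hom, auto simp: opposite_def
        intro: src_in_Ob tgt_in_Ob ident_in_Hom cmp_in_Hom cmp_ident_left cmp_ident_right
          cmp_assoc[symmetric])
qed


section \<open>Categorical invariants and persistent objects\<close>

locale categorical_invariant = category C for C :: "('o, 'm) cat" (structure) +
  fixes I :: "'o + 'm \<Rightarrow> 'n::order"
  assumes inv_ident: "X \<in> Ob C \<Longrightarrow> I (Inr (ident C X)) = I (Inl X)"
    and inv_cmp: "f \<in> Hom C X Y \<Longrightarrow> g \<in> Hom C Y W \<Longrightarrow> h \<in> Hom C W Z
      \<Longrightarrow> I (Inr (h \<cdot> g \<cdot> f)) \<le> I (Inr g)"

type_synonym ('o, 'm) pers = "(real, real \<times> real, 'o, 'm) func"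

abbreviation persistent_object :: "('o, 'm) cat \<Rightarrow> ('o, 'm) pers \<Rightarrow> bool" where
  "persistent_object C F \<equiv> category_functor poset_category C F"

text \<open>
  The order on the type \<^typ>\<open>real interval\<close> of nonempty closed intervals is inclusion, so
  \<^const>\<open>poset_category\<close> at this type is the category of closed intervals.  In the opposite of the
  category of \<open>'n\<close>, the morphism \<open>x \<rightarrow> y\<close> (for \<open>y \<le> x\<close>) is the pair \<open>(y, x)\<close>.
\<close>

lemma interval_le_iff_subset: "i \<le> j \<longleftrightarrow> set_of i \<subseteq> set_of j" for i j :: "real interval"
  by (simp add: less_eq_interval_def set_of_eq)

type_synonym 'n intfunc = "(real interval, real interval \<times> real interval, 'n, 'n \<times> 'n) func"

definition persistence_invariant :: "('o + 'm \<Rightarrow> 'n::order) \<Rightarrow> ('o, 'm) pers \<Rightarrow> 'n intfunc" where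
  "persistence_invariant I F =
    (let J = (\<lambda>i. I (Inr (on_mor F (lower i, upper i))))
     in \<lparr>on_ob = J, on_mor = (\<lambda>(i, j). (J j, J i))\<rparr>)"

lemma category_functor_persistence_invariant:
  fixes C :: "('o, 'm) cat" and I :: "'o + 'm \<Rightarrow> 'n::order"
  assumes "categorical_invariant C I" and "persistent_object C F"
  shows "category_functor poset_category (opposite poset_category) (persistence_invariant I F)"
proof -
  interpret categorical_invariant C I by fact
  interpret F: category_functor poset_category C F by fact
  have F_Hom: "on_mor F (a, b) \<in> Hom C (on_ob F a) (on_ob F b)" if "a \<le> b" for a b
    using that by (intro F.on_mor_in_Hom) (simp add: Hom_def poset_category_def)
  have F_cmp: "on_mor F (b, c) \<cdot>\<^bsub>C\<^esub> on_mor F (a, b) = on_mor F (a, c)"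
    if "a \<le> b" "b \<le> c" for a b c
    using F.on_mor_cmp[of "(a, b)" a b "(b, c)" c] that
    by (simp add: Hom_def poset_category_def)
  have mono: "I (Inr (on_mor F (lower j, upper j))) \<le> I (Inr (on_mor F (lower i, upper i)))"
    if "i \<le> j" for i j :: "real interval"
  proof -
    have le: "lower j \<le> lower i" "upper i \<le> upper j"
      using that by (simp_all add: less_eq_interval_def)
    have "on_mor F (lower j, upper j) =
        on_mor F (upper i, upper j) \<cdot>\<^bsub>C\<^esub> on_mor F (lower i, upper i) \<cdot>\<^bsub>C\<^esub> on_mor F (lower j, lower i)"
      using le by (simp add: F_cmp order_trans[OF _ lower_le_upper])
    then show ?thesis
      using inv_cmp[OF F_Hom F_Hom F_Hom, of "lower j" "lower i" "upper i" "upper j"] le by simp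
  qed
  interpret P: category "poset_category :: (real interval, _) cat"
    by (rule category_poset_category)
  interpret N: category "opposite (poset_category :: ('n, _) cat)"
    by (intro category_opposite category_poset_category)
  show ?thesis
    by unfold_locales
      (auto simp: persistence_invariant_def Let_def poset_category_def opposite_def Hom_def
        intro: mono)
qed


section \<open>Interleaving and erosion distance\<close>

definition interleaved ::
    "('o, 'm) cat \<Rightarrow> real \<Rightarrow> ('o, 'm) pers \<Rightarrow> ('o, 'm) pers \<Rightarrow> bool" where
  "interleaved C \<epsilon> F G \<longleftrightarrow> (\<exists>\<phi> \<psi>.
     (\<forall>t. \<phi> t \<in> Hom C (on_ob F t) (on_ob G (t + \<epsilon>))) \<and>
     (\<forall>t. \<psi> t \<in> Hom C (on_ob G t) (on_ob F (t + \<epsilon>))) \<and>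
     (\<forall>a b. a \<le> b \<longrightarrow>
        \<phi> b \<cdot>\<^bsub>C\<^esub> on_mor F (a, b) = on_mor G (a + \<epsilon>, b + \<epsilon>) \<cdot>\<^bsub>C\<^esub> \<phi> a) \<and>
     (\<forall>a b. a \<le> b \<longrightarrow>
        \<psi> b \<cdot>\<^bsub>C\<^esub> on_mor G (a, b) = on_mor F (a + \<epsilon>, b + \<epsilon>) \<cdot>\<^bsub>C\<^esub> \<psi> a) \<and>
     (\<forall>t. \<psi> (t + \<epsilon>) \<cdot>\<^bsub>C\<^esub> \<phi> t = on_mor F (t, t + 2 * \<epsilon>)) \<and>
     (\<forall>t. \<phi> (t + \<epsilon>) \<cdot>\<^bsub>C\<^esub> \<psi> t = on_mor G (t, t + 2 * \<epsilon>)))"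

definition interleaving_distance ::
    "('o, 'm) cat \<Rightarrow> ('o, 'm) pers \<Rightarrow> ('o, 'm) pers \<Rightarrow> ennreal" where
  "interleaving_distance C F G = Inf {ennreal \<epsilon> | \<epsilon>. 0 \<le> \<epsilon> \<and> interleaved C \<epsilon> F G}"

definition eroded :: "real \<Rightarrow> 'n::order intfunc \<Rightarrow> 'n intfunc \<Rightarrow> bool" where
  "eroded \<epsilon> J1 J2 \<longleftrightarrow> (\<forall>a b. a \<le> b \<longrightarrow>
     on_ob J1 (Interval (a, b)) \<ge> on_ob J2 (Interval (a - \<epsilon>, b + \<epsilon>)) \<and>
     on_ob J2 (Interval (a, b)) \<ge> on_ob J1 (Interval (a - \<epsilon>, b + \<epsilon>)))"

definition erosion_distance :: "'n::order intfunc \<Rightarrow> 'n intfunc \<Rightarrow> ennreal" where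
  "erosion_distance J1 J2 = Inf {ennreal \<epsilon> | \<epsilon>. 0 \<le> \<epsilon> \<and> eroded \<epsilon> J1 J2}"

end

(* An interleaving factors the transition map of G over [a - \<epsilon>, b + \<epsilon>] through the transition map
   of F over [a, b], so every interleaving parameter is also an erosion parameter. *)
theory Submission
  imports Defs
begin

text \<open>Exchanging \<open>\<phi>\<close> and \<open>\<psi>\<close> permutes the defining
  conditions. This will yield the second erosion inequality from the first.\<close>

lemma interleaved_sym:
  assumes "interleaved C \<epsilon> F G"
  shows "interleaved C \<epsilon> G F"
  using assms unfolding interleaved_def by metis

text \<open>\<open>Interval\<close> is the abstraction map of a typedef, so its endpoints can be
  recovered only for pairs with \<open>a \<le> b\<close>.\<close>

lemma on_ob_persistence_invariant:
  assumes "a \<le> b"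
  shows "on_ob (persistence_invariant I F) (Interval (a, b)) = I (Inr (on_mor F (a, b)))"
  using assms
  by (simp add: persistence_invariant_def Let_def lower.rep_eq upper.rep_eq Interval_inverse)

lemma persistent_object_Hom:
  assumes "persistent_object C F" and "a \<le> b"
  shows "on_mor F (a, b) \<in> Hom C (on_ob F a) (on_ob F b)"
  using category_functor.on_mor_in_Hom[OF assms(1)] assms(2)
  by (simp add: Hom_def poset_category_def)

lemma persistent_object_cmp:
  assumes "persistent_object C F" and "a \<le> b" "b \<le> c"
  shows "on_mor F (b, c) \<cdot>\<^bsub>C\<^esub> on_mor F (a, b) = on_mor F (a, c)"
  using category_functor.on_mor_cmp[OF assms(1), of "(a, b)" a b "(b, c)" c] assms(2,3)
  by (simp add: Hom_def poset_category_def)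

lemma interleaved_invariant_le:
  assumes "categorical_invariant C I"
    and F: "persistent_object C F" and G: "persistent_object C G"
    and "0 \<le> \<epsilon>" and "interleaved C \<epsilon> F G" and "a \<le> b"
  shows "I (Inr (on_mor G (a - \<epsilon>, b + \<epsilon>))) \<le> I (Inr (on_mor F (a, b)))"
proof -
  interpret categorical_invariant C I by fact
  obtain \<phi> \<psi> where \<phi>: "\<And>t. \<phi> t \<in> Hom C (on_ob F t) (on_ob G (t + \<epsilon>))"
    and \<psi>: "\<And>t. \<psi> t \<in> Hom C (on_ob G t) (on_ob F (t + \<epsilon>))"
    and nat: "\<phi> b \<cdot>\<^bsub>C\<^esub> on_mor F (a, b) = on_mor G (a + \<epsilon>, b + \<epsilon>) \<cdot>\<^bsub>C\<^esub> \<phi> a"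
    and \<phi>\<psi>: "\<And>t. \<phi> (t + \<epsilon>) \<cdot>\<^bsub>C\<^esub> \<psi> t = on_mor G (t, t + 2 * \<epsilon>)"
    using \<open>interleaved C \<epsilon> F G\<close> \<open>a \<le> b\<close> unfolding interleaved_def by blast
  \<comment> \<open>Starting at \<open>a - \<epsilon>\<close> makes the shift by
    \<open>\<epsilon>\<close> land exactly at \<open>a\<close>, where \<open>on_mor F (a, b)\<close>
    begins.\<close>
  have \<psi>a: "\<psi> (a - \<epsilon>) \<in> Hom C (on_ob G (a - \<epsilon>)) (on_ob F a)"
    using \<psi>[of "a - \<epsilon>"] by simp
  have \<phi>\<psi>a: "\<phi> a \<cdot>\<^bsub>C\<^esub> \<psi> (a - \<epsilon>) = on_mor G (a - \<epsilon>, a + \<epsilon>)"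
    using \<phi>\<psi>[of "a - \<epsilon>"] by (simp add: add.commute)
  have Fab: "on_mor F (a, b) \<in> Hom C (on_ob F a) (on_ob F b)"
    using F \<open>a \<le> b\<close> by (rule persistent_object_Hom)
  have Gab: "on_mor G (a + \<epsilon>, b + \<epsilon>) \<in> Hom C (on_ob G (a + \<epsilon>)) (on_ob G (b + \<epsilon>))"
    using G \<open>a \<le> b\<close> by (intro persistent_object_Hom) simp_all
  \<comment> \<open>The right-nested triple has the shape required by \<open>inv_cmp\<close>, with
    \<open>on_mor F (a, b)\<close> in the middle. Reassociating exposes the naturality square of
    \<open>\<phi>\<close>.\<close>
  have "\<phi> b \<cdot>\<^bsub>C\<^esub> on_mor F (a, b) \<cdot>\<^bsub>C\<^esub> \<psi> (a - \<epsilon>) =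
      (\<phi> b \<cdot>\<^bsub>C\<^esub> on_mor F (a, b)) \<cdot>\<^bsub>C\<^esub> \<psi> (a - \<epsilon>)"
    by (rule cmp_assoc[OF \<psi>a Fab \<phi>, symmetric])
  also have "\<dots> = on_mor G (a + \<epsilon>, b + \<epsilon>) \<cdot>\<^bsub>C\<^esub> \<phi> a \<cdot>\<^bsub>C\<^esub> \<psi> (a - \<epsilon>)"
    unfolding nat by (rule cmp_assoc[OF \<psi>a \<phi> Gab])
  \<comment> \<open>The round trip through F is a transition map of G, and functoriality of G joins
    the two pieces at \<open>a + \<epsilon>\<close>; \<open>0 \<le> \<epsilon>\<close> gives
    \<open>a - \<epsilon> \<le> a + \<epsilon>\<close>.\<close>
  also have "\<dots> = on_mor G (a - \<epsilon>, b + \<epsilon>)"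
    unfolding \<phi>\<psi>a using G \<open>0 \<le> \<epsilon>\<close> \<open>a \<le> b\<close> by (intro persistent_object_cmp) simp_all
  finally show ?thesis
    using inv_cmp[OF \<psi>a Fab \<phi>] by simp
qed

lemma interleaved_imp_eroded:
  assumes "categorical_invariant C I"
    and "persistent_object C F" and "persistent_object C G"
    and "0 \<le> \<epsilon>" and "interleaved C \<epsilon> F G"
  shows "eroded \<epsilon> (persistence_invariant I F) (persistence_invariant I G)"
  using assms interleaved_sym[OF assms(5)]
  by (simp add: eroded_def on_ob_persistence_invariant interleaved_invariant_le)

theorem theorem1:
  fixes C :: "('o, 'm) cat"
    and I :: "'o + 'm \<Rightarrow> 'n::order"
    and F G :: "('o, 'm) pers"
  assumes "category C"
    and "categorical_invariant C I"
    and "persistent_object C F"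
    and "persistent_object C G"
  shows "erosion_distance (persistence_invariant I F) (persistence_invariant I G)
    \<le> interleaving_distance C F G"
  \<comment> \<open>The infimum over a larger set is smaller; if no interleaving exists, the
    right-hand side is the infimum of the empty set, which is \<open>\<infinity>\<close>.\<close>
  unfolding erosion_distance_def interleaving_distance_def
  using interleaved_imp_eroded[OF assms(2-4)] by (intro Inf_superset_mono) blast

end
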